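(* For $y\in[0,1]$, $\max_y\,-y\log y=1/e$. Let $q\in\mathbb{N}$, let $\mathbb{X}\subset\mathbb{Z}^q$, let $\mathcal{F}$ be a class of probability mass functions (PMFs) on $\mathbb{X}$, let $\boldsymbol{c}=\{c_S\}_{S\in\mathbb{S}}$ and $\boldsymbol{d}=\{d_T\}_{T\in\mathbb{T}}$ be families of constants in $[0,\infty)$ that are not both identically zero, and let $\mathbf{X}_n=\{\boldsymbol{X}_i\}_{i=1}^n$ be an independent and identically distributed sample from a distribution with PMF $f_0\in\mathcal{F}$. If $\mathbb{X}$ is a bounded set, then the pseudo-entropy $H(f_0)$ is finite (being a finite sum of finite values). Consequently, if $\tilde f_n\in\mathcal{F}$ is the maximum pseudolikelihood estimator, that is, $L^{\boldsymbol{cd}}_{\tilde f_n}(\mathbf{X}_n)=\max_{f\in\mathcal{F}}L^{\boldsymbol{cd}}_f(\mathbf{X}_n)$, with all relevant marginal and conditional PMFs $\tilde f_n^S$ (those with $c_S\neq 0$) and $\tilde f_n^T(\cdot|\cdot)$ (those with $d_T\neq 0$) compatible with $\tilde f_n$, then $\tilde f_n$ is a consistent estimator for $f_0$, meaning that, for all relevant $S$ and $T$ (i.e. $c_S\neq 0$ and $d_T\neq 0$), as $n\to\infty$, $$\tilde f_n^S(\boldsymbol{x}^S)\to f_0^S(\boldsymbol{x}^S)\quad\text{and}\quad \tilde f_n^T\left(\boldsymbol{x}^{\overleftarrow{T}}|\boldsymbol{x}^{\overrightarrow{T}}\right)\to f_0^T\left(\boldsymbol{x}^{\overleftarrow{T}}|\boldsymbol{x}^{\overrightarrow{T}}\right)$$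 with probability $1$, for every $\boldsymbol{x}^S\in\mathbb{X}^S$, every $\boldsymbol{x}^{\overleftarrow{T}}\in\mathbb{X}^{\overleftarrow{T}}$ and every $\boldsymbol{x}^{\overrightarrow{T}}\in\mathbb{X}^{\overrightarrow{T}}$.
   Context: Write $[q]=\{1,\dots,q\}$. $\mathbb{S}$ is the set of all non-empty subsets of $[q]$. $\mathbb{T}$ is the set of partitions of all subsets of $[q]$ into two non-empty sets; for $T\in\mathbb{T}$ the two sets are called the left set $\overleftarrow{T}$ and the right set $\overrightarrow{T}$. For a vector $\boldsymbol{x}$ and $A\subset[q]$, $\boldsymbol{x}^A$ is the subvector of the coordinates of $\boldsymbol{x}$ indexed by $A$, and $\mathbb{X}^A$ is the corresponding set of coordinates of $\mathbb{X}$, i.e. $\{\boldsymbol{x}^A:\boldsymbol{x}\in\mathbb{X}\}$. For a PMF $f$ on $\mathbb{X}$, $f^A$ is the marginal PMF of the coordinates in a non-empty $A\subset[q]$, and, for $T\in\mathbb{T}$, $f^T(\boldsymbol{x}^{\overleftarrow{T}}|\boldsymbol{x}^{\overrightarrow{T}})$ is the conditional PMF, under $f$, of the coordinates in $\overleftarrow{T}$ given that the coordinates in $\overrightarrow{T}$ equal $\boldsymbol{x}^{\overrightarrow{T}}$. Marginal and conditional PMFs $\tilde f_n^S$, $\tilde f_n^T(\cdot|\cdot)$ are compatible with $\tilde f_n$ if they can be computed from the joint PMF $\tilde f_n$ by the usual laws for deriving marginal and conditional PMFs. The (log-)pseudolikelihood function is $$L_f^{\boldsymbol{cd}}(\mathbf{X}_n)=\sum_{i=1}^n\sum_{S\in\mathbb{S}}c_S\log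 f^S(\boldsymbol{X}_i^S)+\sum_{i=1}^n\sum_{T\in\mathbb{T}}d_T\log f^T\left(\boldsymbol{X}_i^{\overleftarrow{T}}|\boldsymbol{X}_i^{\overrightarrow{T}}\right).$$ The maximum pseudolikelihood estimator $\tilde f_n$ is any element of $\mathcal{F}$ attaining the maximum of $L_f^{\boldsymbol{cd}}(\mathbf{X}_n)$ over $f\in\mathcal{F}$. The pseudo-entropy of $f\in\mathcal{F}$ is $$H(f)=\sum_{S\in\mathbb{S}}\sum_{\boldsymbol{x}^S\in\mathbb{X}^S}-c_Sf^S(\boldsymbol{x}^S)\log f^S(\boldsymbol{x}^S)+\sum_{T\in\mathbb{T}}d_T\sum_{\boldsymbol{x}^{\overrightarrow{T}}\in\mathbb{X}^{\overrightarrow{T}}}\ \sum_{\boldsymbol{x}^{\overleftarrow{T}}\in\mathbb{X}^{\overleftarrow{T}}}-f^T(\boldsymbol{x}^{\overleftarrow{T}}|\boldsymbol{x}^{\overrightarrow{T}})\log f^T(\boldsymbol{x}^{\overleftarrow{T}}|\boldsymbol{x}^{\overrightarrow{T}}),$$ with the convention $0\times\log 0=0$.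
   Formalization: Convergence of the conditional PMFs is stated only for conditioning values whose marginal probability under f_0 is positive; for other values in the coordinate set the conditional PMF of f_0 is undefined. *)

theory Defs
  imports "HOL-Probability.Probability"
begin

text \<open>
  Points of \<open>\<int>\<^sup>q\<close> are vectors of type \<^typ>\<open>int ^ 'q\<close>, so that \<open>'q\<close> plays the role of
  \<open>[q] = {1, \<dots>, q}\<close>, and subvectors are functions equal to \<^term>\<open>undefined\<close> outside
  the index set.
\<close>

definition subvec :: "'q set \<Rightarrow> int ^ 'q \<Rightarrow> 'q \<Rightarrow> int"
  where "subvec A x = restrict (\<lambda>i. x $ i) A"

definition coords :: "'q set \<Rightarrow> (int ^ 'q) set \<Rightarrow> ('q \<Rightarrow> int) set"
  where "coords A X = subvec A ` X"

definition nonempty_subsets :: "'q set set"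
  where "nonempty_subsets = {S. S \<noteq> {}}"

definition bipartitions :: "('q set \<times> 'q set) set"
  where "bipartitions = {(L, R). L \<noteq> {} \<and> R \<noteq> {} \<and> L \<inter> R = {}}"

abbreviation left_set :: "'q set \<times> 'q set \<Rightarrow> 'q set"
  where "left_set T \<equiv> fst T"

abbreviation right_set :: "'q set \<times> 'q set \<Rightarrow> 'q set"
  where "right_set T \<equiv> snd T"

definition marginal :: "'q set \<Rightarrow> (int ^ 'q) pmf \<Rightarrow> ('q \<Rightarrow> int) pmf"
  where "marginal A f = map_pmf (subvec A) f"

text \<open>
  \<open>conditional T f a b\<close> is \<open>f\<^sup>T(a | b)\<close>. It is meaningful only if the marginal PMF of the
  right coordinates is positive at \<open>b\<close>; otherwise \<^const>\<open>cond_prob\<close> divides by zero and the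
  value is \<open>0\<close>.
\<close>

definition conditional ::
    "'q set \<times> 'q set \<Rightarrow> (int ^ 'q) pmf \<Rightarrow> ('q \<Rightarrow> int) \<Rightarrow> ('q \<Rightarrow> int) \<Rightarrow> real"
  where "conditional T f a b =
    cond_prob (measure_pmf f) (\<lambda>x. subvec (left_set T) x = a) (\<lambda>x. subvec (right_set T) x = b)"

text \<open>
  The library has \<^term>\<open>ln (0::real) = 0\<close>, which would reward a PMF for giving probability
  zero to an observation, so the log-pseudolikelihood uses \<open>log 0 = -\<infinity>\<close>. In particular it is
  \<open>-\<infinity>\<close> if a relevant conditional PMF is undefined at an observation. Terms with a zero
  coefficient vanish because \<open>0 * (-\<infinity>) = 0\<close> in \<^typ>\<open>ereal\<close>.
\<close>

definition log_prob :: "real \<Rightarrow> ereal"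
  where "log_prob p = (if p = 0 then -\<infinity> else ereal (ln p))"

definition log_pseudolikelihood ::
    "('q::finite set \<Rightarrow> real) \<Rightarrow> ('q set \<times> 'q set \<Rightarrow> real) \<Rightarrow> nat \<Rightarrow> (nat \<Rightarrow> int ^ 'q)
      \<Rightarrow> (int ^ 'q) pmf \<Rightarrow> ereal"
  where "log_pseudolikelihood c d n xs f =
    (\<Sum>i=1..n. \<Sum>S\<in>nonempty_subsets.
        ereal (c S) * log_prob (pmf (marginal S f) (subvec S (xs i)))) +
    (\<Sum>i=1..n. \<Sum>T\<in>bipartitions.
        ereal (d T) *
        log_prob (conditional T f (subvec (left_set T) (xs i)) (subvec (right_set T) (xs i))))"

definition is_max_pseudolikelihood ::
    "(int ^ 'q) pmf set \<Rightarrow> ('q::finite set \<Rightarrow> real) \<Rightarrow> ('q set \<times> 'q set \<Rightarrow> real) \<Rightarrow> nat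
      \<Rightarrow> (nat \<Rightarrow> int ^ 'q) \<Rightarrow> (int ^ 'q) pmf \<Rightarrow> bool"
  where "is_max_pseudolikelihood F c d n xs f \<longleftrightarrow>
    is_arg_max (log_pseudolikelihood c d n xs) (\<lambda>g. g \<in> F) f"

text \<open>
  The marginals \<open>fS S\<close> and conditionals \<open>fT T b\<close> (given \<open>b\<close>) are those of \<open>f\<close>, for all
  relevant \<open>S\<close> and \<open>T\<close>; nothing is required of \<open>fT T b\<close> if \<open>b\<close> has probability zero.
\<close>

definition compatible ::
    "('q set \<Rightarrow> real) \<Rightarrow> ('q set \<times> 'q set \<Rightarrow> real) \<Rightarrow> (int ^ 'q) pmf
      \<Rightarrow> ('q set \<Rightarrow> ('q \<Rightarrow> int) pmf) \<Rightarrow> ('q set \<times> 'q set \<Rightarrow> ('q \<Rightarrow> int) \<Rightarrow> ('q \<Rightarrow> int) pmf) \<Rightarrow> bool"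
  where "compatible c d f fS fT \<longleftrightarrow>
    (\<forall>S\<in>nonempty_subsets. c S \<noteq> 0 \<longrightarrow> fS S = marginal S f) \<and>
    (\<forall>T\<in>bipartitions. d T \<noteq> 0 \<longrightarrow>
      (\<forall>b. pmf (marginal (right_set T) f) b > 0 \<longrightarrow>
        (\<forall>a. pmf (fT T b) a = conditional T f a b)))"

text \<open>
  The inner sums range over possibly infinite sets and have nonnegative terms, hence are
  extended reals. Here \<^term>\<open>ln (0::real) = 0\<close> is harmless and gives \<open>0 log 0 = 0\<close>.
\<close>

definition pseudo_entropy ::
    "(int ^ 'q) set \<Rightarrow> ('q::finite set \<Rightarrow> real) \<Rightarrow> ('q set \<times> 'q set \<Rightarrow> real)
      \<Rightarrow> (int ^ 'q) pmf \<Rightarrow> ereal"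
  where "pseudo_entropy X c d f =
    (\<Sum>S\<in>nonempty_subsets. \<Sum>\<^sub>\<infinity>x\<in>coords S X.
        ereal (- c S * pmf (marginal S f) x * ln (pmf (marginal S f) x))) +
    (\<Sum>T\<in>bipartitions. ereal (d T) *
      (\<Sum>\<^sub>\<infinity>b\<in>coords (right_set T) X. \<Sum>\<^sub>\<infinity>a\<in>coords (left_set T) X.
        ereal (- conditional T f a b * ln (conditional T f a b))))"

end

theory Submission
  imports Defs
begin

text \<open>
  Write \<open>P\<^sub>n\<close> for the empirical PMF of the sample. The likelihood of \<open>f\<close> differs from
  a quantity independent of \<open>f\<close> by \<open>-n\<close> times a weighted sum of (conditional)
  Kullback-Leibler divergences of \<open>f\<close> from \<open>P\<^sub>n\<close>. A maximiser makes this sum at most its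
  value at \<open>f\<^sub>0\<close>, which tends to \<open>0\<close> because \<open>P\<^sub>n\<close> tends to \<open>f\<^sub>0\<close> almost surely
  (Hoeffding and Borel-Cantelli) and the support of \<open>f\<^sub>0\<close> is finite. Each divergence dominates
  a squared Hellinger distance, so the marginals and conditionals of the maximiser approach
  those of \<open>P\<^sub>n\<close>, hence those of \<open>f\<^sub>0\<close>.
\<close>

section \<open>Logarithmic inequalities and the Hellinger bound\<close>

lemma neg_mult_ln_le:
  fixes y :: real
  assumes "y \<ge> 0"
  shows "- y * ln y \<le> 1 / exp 1"
proof (cases "y = 0")
  case False
  with assms have y: "y > 0" by simp
  \<comment> \<open>The tangent bound \<open>ln z \<le> z - 1\<close> is sharp at
    \<open>z = 1\<close>, which is the maximiser \<open>y = 1 / exp 1\<close>; the two constants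
    \<open>-1\<close> then cancel.\<close>
  have "ln (1 / (exp 1 * y)) \<le> 1 / (exp 1 * y) - 1"
    using y by (intro ln_le_minus_one) simp
  then have "- ln y \<le> 1 / (exp 1 * y)"
    using y by (simp add: ln_div ln_mult)
  then have "y * - ln y \<le> y * (1 / (exp 1 * y))"
    using y by (intro mult_left_mono) auto
  then show ?thesis using y by simp
qed simp

text \<open>Use \<open>ln t \<le> t - 1\<close> at \<open>t = sqrt (g / p)\<close> rather than at
  \<open>g / p\<close>: the square root leaves a Hellinger term, so that the summed bound controls a
  distance and not just a sign. The assumption \<open>pg\<close> keeps \<open>ln g\<close> away from
  the default \<open>ln 0 = 0\<close>.\<close>

lemma ln_ratio_ge_sqrt:
  fixes p g :: real
  assumes p: "p \<ge> 0" and g: "g \<ge> 0" and pg: "p > 0 \<Longrightarrow> g > 0"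
  shows "2 * p - 2 * (sqrt p * sqrt g) \<le> p * (ln p - ln g)"
proof (cases "p = 0")
  case False
  with p pg have p: "p > 0" and g: "g > 0" by auto
  have "ln (sqrt (g / p)) \<le> sqrt (g / p) - 1"
    using p g by (intro ln_le_minus_one) simp
  then have "2 - 2 * sqrt (g / p) \<le> ln p - ln g"
    using p g by (simp add: ln_sqrt ln_div)
  then have "p * (2 - 2 * sqrt (g / p)) \<le> p * (ln p - ln g)"
    using p by (intro mult_left_mono) auto
  moreover have "p * sqrt (g / p) = sqrt p * sqrt g"
    using p by (simp add: real_sqrt_divide field_simps)
  ultimately show ?thesis by (simp add: algebra_simps)
qed simp

text \<open>Expand the squares, replace \<open>sum g A\<close> by the larger \<open>sum p A\<close>,
  and apply the pointwise bound. An inequality between the masses is assumed because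
  \<open>g\<close> will be a kernel with possible mass outside \<open>A\<close>.\<close>

lemma hellinger_le_relative_entropy:
  fixes p g :: "'a \<Rightarrow> real"
  assumes p: "\<And>a. a \<in> A \<Longrightarrow> p a \<ge> 0" and g: "\<And>a. a \<in> A \<Longrightarrow> g a \<ge> 0"
    and pg: "\<And>a. a \<in> A \<Longrightarrow> p a > 0 \<Longrightarrow> g a > 0"
    and sum_le: "sum g A \<le> sum p A"
  shows "(\<Sum>a\<in>A. (sqrt (p a) - sqrt (g a))\<^sup>2) \<le> (\<Sum>a\<in>A. p a * (ln (p a) - ln (g a)))"
proof -
  have "(\<Sum>a\<in>A. (sqrt (p a) - sqrt (g a))\<^sup>2) = (\<Sum>a\<in>A. p a + g a - 2 * (sqrt (p a) * sqrt (g a)))"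
    using p g by (intro sum.cong) (auto simp: power2_diff)
  also have "\<dots> = sum p A + sum g A - (\<Sum>a\<in>A. 2 * (sqrt (p a) * sqrt (g a)))"
    by (simp add: sum.distrib sum_subtractf)
  also have "\<dots> \<le> sum p A + sum p A - (\<Sum>a\<in>A. 2 * (sqrt (p a) * sqrt (g a)))"
    using sum_le by simp
  also have "\<dots> = (\<Sum>a\<in>A. 2 * p a - 2 * (sqrt (p a) * sqrt (g a)))"
    by (simp add: sum_subtractf sum_distrib_left)
  also have "\<dots> \<le> (\<Sum>a\<in>A. p a * (ln (p a) - ln (g a)))"
    using p g pg by (intro sum_mono ln_ratio_ge_sqrt) auto
  finally show ?thesis .
qed

section \<open>Conditional PMFs of a pair and their relative entropy\<close>

text \<open>The conditional probability of the first component given the second, equal to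
  \<open>0\<close> when \<open>b\<close> is null.\<close>

definition cond_kernel :: "('a \<times> 'b) pmf \<Rightarrow> 'a \<Rightarrow> 'b \<Rightarrow> real"
  where "cond_kernel Q a b = pmf Q (a, b) / pmf (map_pmf snd Q) b"

lemma cond_kernel_nonneg: "cond_kernel Q a b \<ge> 0"
  by (simp add: cond_kernel_def)

lemma pmf_le_pmf_snd: "pmf Q (a, b) \<le> pmf (map_pmf snd Q) b"
proof -
  have "pmf Q (a, b) = measure_pmf.prob Q {(a, b)}"
    by (simp add: measure_pmf_single)
  also have "\<dots> \<le> measure_pmf.prob Q (snd -` {b})"
    by (intro measure_pmf.finite_measure_mono) auto
  finally show ?thesis by (simp add: pmf_map)
qed

lemma cond_kernel_le_1: "cond_kernel Q a b \<le> 1"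
  using pmf_le_pmf_snd[of Q a b] by (auto simp: cond_kernel_def divide_le_eq_1 less_le)

lemma cond_kernel_pos_iff: "cond_kernel Q a b > 0 \<longleftrightarrow> (a, b) \<in> set_pmf Q"
proof
  show "(a, b) \<in> set_pmf Q" if "cond_kernel Q a b > 0"
    using that by (auto simp: cond_kernel_def set_pmf_iff)
  show "cond_kernel Q a b > 0" if "(a, b) \<in> set_pmf Q"
    using pmf_positive[OF that] less_le_trans[OF pmf_positive[OF that] pmf_le_pmf_snd]
    by (simp add: cond_kernel_def)
qed

lemma sum_pmf_slice_le:
  assumes "finite A"
  shows "(\<Sum>a\<in>A. pmf Q (a, b)) \<le> pmf (map_pmf snd Q) b"
proof -
  have "(\<Sum>a\<in>A. pmf Q (a, b)) = sum (pmf Q) ((\<lambda>a. (a, b)) ` A)"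
    by (subst sum.reindex) (auto simp: inj_on_def)
  also have "\<dots> = measure_pmf.prob Q ((\<lambda>a. (a, b)) ` A)"
    using assms by (simp add: measure_measure_pmf_finite)
  also have "\<dots> \<le> measure_pmf.prob Q (snd -` {b})"
    by (intro measure_pmf.finite_measure_mono) auto
  finally show ?thesis by (simp add: pmf_map)
qed

lemma sum_pmf_slice_eq:
  assumes "finite A" and "fst ` set_pmf Q \<subseteq> A"
  shows "(\<Sum>a\<in>A. pmf Q (a, b)) = pmf (map_pmf snd Q) b"
proof -
  have "(\<Sum>a\<in>A. pmf Q (a, b)) = sum (pmf Q) ((\<lambda>a. (a, b)) ` A)"
    by (subst sum.reindex) (auto simp: inj_on_def)
  also have "\<dots> = measure_pmf.prob Q ((\<lambda>a. (a, b)) ` A)"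
    using assms by (simp add: measure_measure_pmf_finite)
  also have "\<dots> = measure_pmf.prob Q (snd -` {b})"
    using assms(2) by (intro measure_pmf.finite_measure_eq_AE) (force simp: AE_measure_pmf_iff)+
  finally show ?thesis by (simp add: pmf_map)
qed

lemma sum_cond_kernel_le_1:
  assumes "finite A"
  shows "(\<Sum>a\<in>A. cond_kernel Q a b) \<le> 1"
  using sum_pmf_slice_le[OF assms, of Q b]
  by (auto simp: cond_kernel_def divide_le_eq_1 less_le simp flip: sum_divide_distrib)

text \<open>The right-hand side is the conditional relative entropy of \<open>G\<close> from
  \<open>Q\<close>: the average, over the second marginal of \<open>Q\<close>, of the relative
  entropies between the two kernels. Each of these dominates a squared Hellinger distance, and the
  left-hand side is one nonnegative term of the total.\<close>

lemma cond_kernel_hellinger_le: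
  fixes Q G :: "('a \<times> 'b) pmf"
  assumes fin: "finite (set_pmf Q)" and QG: "set_pmf Q \<subseteq> set_pmf G"
  shows "pmf (map_pmf snd Q) b0 * (sqrt (cond_kernel Q a0 b0) - sqrt (cond_kernel G a0 b0))\<^sup>2
    \<le> measure_pmf.expectation Q (\<lambda>(a, b). ln (cond_kernel Q a b) - ln (cond_kernel G a b))"
proof -
  \<comment> \<open>Inserting \<open>a0\<close> and \<open>b0\<close> makes their term occur in the
    sums even if it lies outside the support of \<open>Q\<close>.\<close>
  define A where "A = insert a0 (fst ` set_pmf Q)"
  define B where "B = insert b0 (snd ` set_pmf Q)"
  define h where "h b = pmf (map_pmf snd Q) b * (\<Sum>a\<in>A. (sqrt (cond_kernel Q a b) - sqrt (cond_kernel G a b))\<^sup>2)" for b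
  have finAB: "finite A" "finite B" using fin by (auto simp: A_def B_def)
  have le: "h b \<le> (\<Sum>a\<in>A. pmf Q (a, b) * (ln (cond_kernel Q a b) - ln (cond_kernel G a b)))" for b
  proof (cases "pmf (map_pmf snd Q) b = 0")
    case True
    then have "pmf Q (a, b) = 0" for a
      using pmf_le_pmf_snd[of Q a b] by (simp add: order_antisym)
    then show ?thesis using True by (simp add: h_def)
  next
    case False
    have eq: "pmf Q (a, b) = pmf (map_pmf snd Q) b * cond_kernel Q a b" for a
      using False by (simp add: cond_kernel_def)
    \<comment> \<open>\<open>A\<close> contains every first component in the support of
      \<open>Q\<close>, so no mass is lost; the kernel of \<open>G\<close> has mass at most
      \<open>1\<close> on \<open>A\<close>, as the Hellinger bound requires.\<close>
    have "(\<Sum>a\<in>A. cond_kernel Q a b) = 1"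
      using sum_pmf_slice_eq[OF finAB(1), of Q b] False
      by (simp add: cond_kernel_def A_def subset_insertI flip: sum_divide_distrib)
    then have "(\<Sum>a\<in>A. (sqrt (cond_kernel Q a b) - sqrt (cond_kernel G a b))\<^sup>2)
        \<le> (\<Sum>a\<in>A. cond_kernel Q a b * (ln (cond_kernel Q a b) - ln (cond_kernel G a b)))"
      using sum_cond_kernel_le_1[OF finAB(1), of G b] QG
      by (intro hellinger_le_relative_entropy) (auto simp: cond_kernel_nonneg cond_kernel_pos_iff)
    then have "h b \<le> pmf (map_pmf snd Q) b *
        (\<Sum>a\<in>A. cond_kernel Q a b * (ln (cond_kernel Q a b) - ln (cond_kernel G a b)))"
      unfolding h_def by (intro mult_left_mono) auto
    then show ?thesis unfolding eq by (simp add: sum_distrib_left mult.assoc)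
  qed
  have "pmf (map_pmf snd Q) b0 * (sqrt (cond_kernel Q a0 b0) - sqrt (cond_kernel G a0 b0))\<^sup>2 \<le> h b0"
    unfolding h_def using finAB
    by (intro mult_left_mono member_le_sum) (auto simp: A_def)
  also have "\<dots> \<le> sum h B"
    using finAB by (intro member_le_sum) (auto simp: B_def h_def intro!: mult_nonneg_nonneg sum_nonneg)
  also have "\<dots> \<le> (\<Sum>b\<in>B. \<Sum>a\<in>A. pmf Q (a, b) * (ln (cond_kernel Q a b) - ln (cond_kernel G a b)))"
    by (intro sum_mono le)
  also have "\<dots> = (\<Sum>(a, b)\<in>A \<times> B. (ln (cond_kernel Q a b) - ln (cond_kernel G a b)) * pmf Q (a, b))"
    by (subst sum.swap) (simp add: sum.cartesian_product mult.commute)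
  also have "\<dots> = measure_pmf.expectation Q (\<lambda>(a, b). ln (cond_kernel Q a b) - ln (cond_kernel G a b))"
    by (subst integral_measure_pmf_real[where A = "A \<times> B"])
      (use finAB in \<open>force simp: A_def B_def case_prod_unfold\<close>)+
  finally show ?thesis .
qed

section \<open>Consistency for deterministic sequences of PMFs\<close>

text \<open>Once \<open>P n\<close> lives on the finite support of \<open>f0\<close>, the mass of
  \<open>y\<close> is a sum over the same finite part of its fibre for all such \<open>n\<close>, so
  pointwise convergence suffices.\<close>

lemma tendsto_pmf_map:
  fixes P :: "nat \<Rightarrow> 'x pmf"
  assumes fin: "finite (set_pmf f0)"
    and supp: "\<forall>\<^sub>F n in sequentially. set_pmf (P n) \<subseteq> set_pmf f0"
    and conv: "\<And>x. x \<in> set_pmf f0 \<Longrightarrow> (\<lambda>n. pmf (P n) x) \<longlonglongrightarrow> pmf f0 x"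
  shows "(\<lambda>n. pmf (map_pmf u (P n)) y) \<longlonglongrightarrow> pmf (map_pmf u f0) y"
proof -
  define A where "A = u -` {y} \<inter> set_pmf f0"
  have eq: "pmf (map_pmf u Q) y = (\<Sum>x\<in>A. pmf Q x)" if "set_pmf Q \<subseteq> set_pmf f0" for Q
  proof -
    have "pmf (map_pmf u Q) y = measure_pmf.prob Q A"
      unfolding pmf_map A_def using that
      by (intro measure_pmf.finite_measure_eq_AE) (auto simp: AE_measure_pmf_iff)
    then show ?thesis using fin by (simp add: measure_measure_pmf_finite A_def)
  qed
  have "(\<lambda>n. \<Sum>x\<in>A. pmf (P n) x) \<longlonglongrightarrow> (\<Sum>x\<in>A. pmf f0 x)"
    by (intro tendsto_sum conv) (auto simp: A_def)
  moreover have "\<forall>\<^sub>F n in sequentially. (\<Sum>x\<in>A. pmf (P n) x) = pmf (map_pmf u (P n)) y"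
    using supp by eventually_elim (simp add: eq)
  ultimately show ?thesis
    by (simp add: eq[of f0] Lim_transform_eventually)
qed

lemma tendsto_cond_kernel:
  fixes P :: "nat \<Rightarrow> 'x pmf" and U :: "'x \<Rightarrow> 'a \<times> 'b"
  assumes fin: "finite (set_pmf f0)"
    and supp: "\<forall>\<^sub>F n in sequentially. set_pmf (P n) \<subseteq> set_pmf f0"
    and conv: "\<And>x. x \<in> set_pmf f0 \<Longrightarrow> (\<lambda>n. pmf (P n) x) \<longlonglongrightarrow> pmf f0 x"
    and b: "pmf (map_pmf (snd \<circ> U) f0) b > 0"
  shows "(\<lambda>n. cond_kernel (map_pmf U (P n)) a b) \<longlonglongrightarrow> cond_kernel (map_pmf U f0) a b"
  using b unfolding cond_kernel_def
  by (intro tendsto_divide tendsto_pmf_map[OF fin supp conv])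
    (auto simp: map_pmf_comp comp_def intro!: tendsto_pmf_map[OF fin supp conv])

text \<open>Here \<open>P\<close> plays the empirical PMF, \<open>f\<close> the maximiser, and
  \<open>K g j x\<close> the \<open>j\<close>-th conditional probability of the observation
  \<open>x\<close> under \<open>g\<close>. Assumption \<open>cover\<close> makes the logarithms
  under \<open>f n\<close> genuine on the support of \<open>P n\<close>, and \<open>max\<close>
  compares mean log-likelihoods. Nonnegativity of every divergence lets a bound on the weighted sum
  control the single index \<open>i\<close>.\<close>

lemma cond_kernel_consistency:
  fixes P f :: "nat \<Rightarrow> 'x pmf" and U :: "'j \<Rightarrow> 'x \<Rightarrow> 'a \<times> 'b" and w :: "'j \<Rightarrow> real"
  defines "K \<equiv> \<lambda>g j x. cond_kernel (map_pmf (U j) g) (fst (U j x)) (snd (U j x))"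
  assumes J: "finite J" and w: "\<And>j. j \<in> J \<Longrightarrow> w j > 0"
    and fin: "finite (set_pmf f0)"
    and supp: "\<forall>\<^sub>F n in sequentially. set_pmf (P n) \<subseteq> set_pmf f0"
    and conv: "\<And>x. x \<in> set_pmf f0 \<Longrightarrow> (\<lambda>n. pmf (P n) x) \<longlonglongrightarrow> pmf f0 x"
    and cover: "\<forall>\<^sub>F n in sequentially. \<forall>j\<in>J. set_pmf (map_pmf (U j) (P n)) \<subseteq> set_pmf (map_pmf (U j) (f n))"
    and max: "\<forall>\<^sub>F n in sequentially.
      measure_pmf.expectation (P n) (\<lambda>x. \<Sum>j\<in>J. w j * ln (K f0 j x)) \<le>
      measure_pmf.expectation (P n) (\<lambda>x. \<Sum>j\<in>J. w j * ln (K (f n) j x))"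
    and i: "i \<in> J" and b: "pmf (map_pmf (snd \<circ> U i) f0) b > 0"
  shows "(\<lambda>n. cond_kernel (map_pmf (U i) (f n)) a b) \<longlonglongrightarrow> cond_kernel (map_pmf (U i) f0) a b"
    and "\<forall>\<^sub>F n in sequentially. pmf (map_pmf (snd \<circ> U i) (f n)) b > 0"
proof -
  have w0: "w j \<ge> 0" if "j \<in> J" for j
    using w[OF that] by simp
  \<comment> \<open>The conditional relative entropy of \<open>g\<close> from \<open>P n\<close>.
    Its first logarithm does not depend on \<open>g\<close>, so a larger likelihood means a smaller
    weighted sum of these.\<close>
  define D where "D n g j = measure_pmf.expectation (P n) (\<lambda>x. ln (K (P n) j x) - ln (K g j x))" for n g j
  have D_ge: "pmf (map_pmf (snd \<circ> U j) (P n)) b *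
      (sqrt (cond_kernel (map_pmf (U j) (P n)) a b) - sqrt (cond_kernel (map_pmf (U j) g) a b))\<^sup>2 \<le> D n g j"
    if "set_pmf (P n) \<subseteq> set_pmf f0" "set_pmf (map_pmf (U j) (P n)) \<subseteq> set_pmf (map_pmf (U j) g)"
    for n g j a b
  proof -
    have "finite (set_pmf (map_pmf (U j) (P n)))"
      using fin that(1) by (auto intro: finite_subset)
    from cond_kernel_hellinger_le[OF this that(2), of b a] show ?thesis
      by (simp add: D_def K_def map_pmf_comp comp_def case_prod_unfold)
  qed
  have D_nonneg: "D n g j \<ge> 0"
    if "set_pmf (P n) \<subseteq> set_pmf f0" "set_pmf (map_pmf (U j) (P n)) \<subseteq> set_pmf (map_pmf (U j) g)" for n g j
    by (rule order_trans[OF _ D_ge[OF that]]) (auto intro!: mult_nonneg_nonneg)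

  have D_f_nonneg: "\<forall>\<^sub>F n in sequentially. \<forall>j\<in>J. D n (f n) j \<ge> 0"
    using supp cover by eventually_elim (blast intro: D_nonneg)

  \<comment> \<open>Eventually a sum over the finite support of \<open>f0\<close>, where
    \<open>K f0 j x\<close> is positive; the logarithm is therefore continuous at each limit and
    every difference vanishes.\<close>
  have D_f0: "(\<lambda>n. D n f0 j) \<longlonglongrightarrow> 0" for j
  proof -
    have "(\<lambda>n. \<Sum>x\<in>set_pmf f0. (ln (K (P n) j x) - ln (K f0 j x)) * pmf (P n) x) \<longlonglongrightarrow>
        (\<Sum>x\<in>set_pmf f0. (ln (K f0 j x) - ln (K f0 j x)) * pmf f0 x)"
    proof (intro tendsto_intros conv)
      fix x assume x: "x \<in> set_pmf f0"
      have "snd (U j x) \<in> set_pmf (map_pmf (snd \<circ> U j) f0)"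
        using x by auto
      then show "(\<lambda>n. K (P n) j x) \<longlonglongrightarrow> K f0 j x"
        unfolding K_def by (intro tendsto_cond_kernel[OF fin supp conv] pmf_positive)
      have "(fst (U j x), snd (U j x)) \<in> set_pmf (map_pmf (U j) f0)"
        using x by auto
      then have "K f0 j x > 0" unfolding K_def cond_kernel_pos_iff .
      then show "K f0 j x \<noteq> 0" by simp
    qed auto
    then have "(\<lambda>n. \<Sum>x\<in>set_pmf f0. (ln (K (P n) j x) - ln (K f0 j x)) * pmf (P n) x) \<longlonglongrightarrow> 0"
      by simp
    moreover have "\<forall>\<^sub>F n in sequentially.
        (\<Sum>x\<in>set_pmf f0. (ln (K (P n) j x) - ln (K f0 j x)) * pmf (P n) x) = D n f0 j"
      using supp unfolding D_def
      by eventually_elim (rule integral_measure_pmf_real[symmetric], use fin in auto)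
    ultimately show ?thesis by (rule Lim_transform_eventually)
  qed
  have D_sum: "\<forall>\<^sub>F n in sequentially. (\<Sum>j\<in>J. w j * D n (f n) j) \<le> (\<Sum>j\<in>J. w j * D n f0 j)"
    using supp max
  proof eventually_elim
    case (elim n)
    have "finite (set_pmf (P n))" using fin elim(1) by (rule rev_finite_subset)
    note int = integrable_measure_pmf_finite[OF this]
    have "(\<Sum>j\<in>J. w j * D n g j) = measure_pmf.expectation (P n) (\<lambda>x. \<Sum>j\<in>J. w j * ln (K (P n) j x))
        - measure_pmf.expectation (P n) (\<lambda>x. \<Sum>j\<in>J. w j * ln (K g j x))" for g
      unfolding D_def
      by (simp add: int Bochner_Integration.integral_sum Bochner_Integration.integral_diff
          right_diff_distrib sum_subtractf)
    then show ?case using elim(2) by simp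
  qed
  \<comment> \<open>One nonnegative term lies below the weighted sum for \<open>f n\<close>, which
    lies below the one for \<open>f0\<close>.\<close>
  have w_D: "(\<lambda>n. w i * D n (f n) i) \<longlonglongrightarrow> 0"
  proof (rule tendsto_sandwich)
    show "\<forall>\<^sub>F n in sequentially. 0 \<le> w i * D n (f n) i"
      using D_f_nonneg by eventually_elim (use w0 i in \<open>auto intro!: mult_nonneg_nonneg\<close>)
    show "\<forall>\<^sub>F n in sequentially. w i * D n (f n) i \<le> (\<Sum>j\<in>J. w j * D n f0 j)"
      using D_f_nonneg D_sum
    proof eventually_elim
      case (elim n)
      have "w i * D n (f n) i \<le> (\<Sum>j\<in>J. w j * D n (f n) j)"
        using w0 elim(1) by (intro member_le_sum[OF i _ J]) (auto intro!: mult_nonneg_nonneg)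
      with elim(2) show ?case by simp
    qed
    have "(\<lambda>n. \<Sum>j\<in>J. w j * D n f0 j) \<longlonglongrightarrow> (\<Sum>j\<in>J. w j * 0)"
      by (intro tendsto_intros D_f0)
    then show "(\<lambda>n. \<Sum>j\<in>J. w j * D n f0 j) \<longlonglongrightarrow> 0" by simp
  qed simp
  have D_f: "(\<lambda>n. D n (f n) i) \<longlonglongrightarrow> 0"
    using tendsto_divide[OF w_D tendsto_const[of "w i"]] w[OF i] by simp

  let ?m = "\<lambda>n. pmf (map_pmf (snd \<circ> U i) (P n)) b"
  let ?s = "\<lambda>n. sqrt (cond_kernel (map_pmf (U i) (P n)) a b) - sqrt (cond_kernel (map_pmf (U i) (f n)) a b)"
  have m: "?m \<longlonglongrightarrow> pmf (map_pmf (snd \<circ> U i) f0) b"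
    by (rule tendsto_pmf_map[OF fin supp conv])
  have ms: "(\<lambda>n. ?m n * (?s n)\<^sup>2) \<longlonglongrightarrow> 0"
  proof (rule tendsto_sandwich[OF _ _ tendsto_const D_f])
    show "\<forall>\<^sub>F n in sequentially. ?m n * (?s n)\<^sup>2 \<le> D n (f n) i"
      using supp cover by eventually_elim (use i in \<open>blast intro: D_ge\<close>)
  qed (auto intro!: always_eventually)
  have m_pos: "\<forall>\<^sub>F n in sequentially. ?m n > 0"
    using order_tendstoD(1)[OF m b] .
  \<comment> \<open>The mass \<open>?m n\<close> of \<open>b\<close> has a positive limit, so it can
    be divided out.\<close>
  have "(\<lambda>n. ?m n * (?s n)\<^sup>2 / ?m n) \<longlonglongrightarrow> 0"
    using tendsto_divide[OF ms m] b by simp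
  moreover have "\<forall>\<^sub>F n in sequentially. ?m n * (?s n)\<^sup>2 / ?m n = (?s n)\<^sup>2"
    using m_pos by eventually_elim simp
  ultimately have "(\<lambda>n. (?s n)\<^sup>2) \<longlonglongrightarrow> 0" by (rule Lim_transform_eventually)
  from tendsto_real_sqrt[OF this] have s: "?s \<longlonglongrightarrow> 0"
    by (simp add: tendsto_rabs_zero_iff)
  have k: "(\<lambda>n. sqrt (cond_kernel (map_pmf (U i) (P n)) a b)) \<longlonglongrightarrow> sqrt (cond_kernel (map_pmf (U i) f0) a b)"
    by (intro tendsto_intros tendsto_cond_kernel[OF fin supp conv b])
  \<comment> \<open>Subtracting \<open>?s n\<close> leaves the square root of the kernel of
    \<open>f n\<close>; squaring recovers the kernel itself.\<close>
  have "(\<lambda>n. (sqrt (cond_kernel (map_pmf (U i) (P n)) a b) - ?s n)\<^sup>2) \<longlonglongrightarrow>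
      (sqrt (cond_kernel (map_pmf (U i) f0) a b) - 0)\<^sup>2"
    by (intro tendsto_intros k s)
  then show "(\<lambda>n. cond_kernel (map_pmf (U i) (f n)) a b) \<longlonglongrightarrow> cond_kernel (map_pmf (U i) f0) a b"
    by (simp add: cond_kernel_nonneg)
  \<comment> \<open>Eventually \<open>b\<close> has positive mass under \<open>P n\<close>, and
    \<open>cover\<close> passes this on to \<open>f n\<close>.\<close>
  show "\<forall>\<^sub>F n in sequentially. pmf (map_pmf (snd \<circ> U i) (f n)) b > 0"
    using m_pos cover
  proof eventually_elim
    case (elim n)
    have "b \<in> snd ` U i ` set_pmf (P n)"
      using elim(1) by (simp add: pmf_positive_iff image_comp)
    moreover have "U i ` set_pmf (P n) \<subseteq> U i ` set_pmf (f n)"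
      using elim(2) i by simp
    ultimately have "b \<in> snd ` U i ` set_pmf (f n)" by blast
    then show ?case by (simp add: pmf_positive_iff image_comp)
  qed
qed

section \<open>Almost sure convergence of the empirical PMF\<close>

text \<open>The strong law for indicators: Hoeffding makes the probability of a deviation of at
  least \<open>e\<close> decay geometrically in \<open>n\<close>, so Borel-Cantelli excludes
  infinitely many of them. The values \<open>e = 1 / (k + 1)\<close> suffice, and being countably
  many they share one null set.\<close>

lemma (in prob_space) AE_frequency_tendsto:
  fixes Xs :: "nat \<Rightarrow> 'a \<Rightarrow> 'x"
  assumes indep: "indep_vars (\<lambda>_. count_space UNIV) Xs {1..}"
    and distr: "\<And>i. i \<ge> 1 \<Longrightarrow> distr M (count_space UNIV) (Xs i) = measure_pmf f0"
  shows "AE \<omega> in M. (\<lambda>n. (\<Sum>i\<in>{1..n}. indicator {x} (Xs i \<omega>)) / real n) \<longlonglongrightarrow> pmf f0 x"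
proof -
  define Y :: "nat \<Rightarrow> 'a \<Rightarrow> real" where "Y i \<omega> = indicator {x} (Xs i \<omega>)" for i \<omega>
  have meas_X: "Xs i \<in> measurable M (count_space UNIV)" if "i \<ge> 1" for i
    using indep that by (auto simp: indep_vars_def)
  have meas_Y: "Y i \<in> borel_measurable M" if "i \<ge> 1" for i
    unfolding Y_def using meas_X[OF that] by (rule measurable_compose) simp
  have distr_Y: "distr M borel (Y i) = distr (measure_pmf f0) borel (indicator {x})" if "i \<ge> 1" for i
  proof -
    have "distr M borel (Y i) = distr (distr M (count_space UNIV) (Xs i)) borel (indicator {x})"
      unfolding Y_def using meas_X[OF that] by (subst distr_distr) (auto simp: comp_def)
    then show ?thesis unfolding distr[OF that] .
  qed
  have exp_Y: "expectation (Y 1) = pmf f0 x"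
  proof -
    have "expectation (Y 1) = integral\<^sup>L (distr M borel (Y 1)) (\<lambda>y. y)"
      by (subst integral_distr) (auto simp: meas_Y)
    also have "\<dots> = pmf f0 x"
      by (subst distr_Y, simp, subst integral_distr) (auto simp: measure_pmf_single)
    finally show ?thesis .
  qed
  have indep_Y: "indep_vars (\<lambda>_. borel) Y {1..n}" for n
  proof -
    have "indep_vars (\<lambda>_. count_space UNIV) Xs {1..n}"
      using indep by (rule indep_vars_subset) auto
    then show ?thesis unfolding Y_def by (rule indep_vars_compose2) auto
  qed
  define dev where "dev n \<omega> = \<bar>(\<Sum>i\<in>{1..n}. Y i \<omega>) / real n - pmf f0 x\<bar>" for n \<omega>
  have dev_meas [measurable]: "dev n \<in> borel_measurable M" for n
    unfolding dev_def using meas_Y by (intro measurable) auto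
  have "AE \<omega> in M. \<forall>\<^sub>F n in sequentially. dev n \<omega> < inverse (real (Suc k))" for k
  proof -
    define e where "e = inverse (real (Suc k))"
    have e: "e > 0" by (simp add: e_def)
    define A where "A n = {\<omega> \<in> space M. dev n \<omega> \<ge> e}" for n
    \<comment> \<open>Written as a power to compare with a geometric series. At \<open>n = 0\<close>
      there is no sample, and the bound is the trivial \<open>2\<close>.\<close>
    have A_le: "prob (A n) \<le> 2 * exp (- 2 * e\<^sup>2) ^ n" for n
    proof (cases "n = 0")
      case True
      then show ?thesis using order_trans[OF prob_le_1[of "A n"], of 2] by simp
    next
      case False
      interpret H: Hoeffding_ineq_iid M "{1..n}" Y "Y 1" 0 1 "pmf f0 x"
      proof unfold_locales
        show "indep_vars (\<lambda>_. borel) Y {1..n}" by (rule indep_Y)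
        show "random_variable borel (Y 1)" by (rule meas_Y) simp
        show "distr M borel (Y i) = distr M borel (Y 1)" if "i \<in> {1..n}" for i
          using distr_Y[of i] distr_Y[of 1] that by simp
        show "AE \<omega> in M. Y 1 \<omega> \<in> {0..1}"
          by (rule AE_I2) (simp add: Y_def)
        show "pmf f0 x \<equiv> expectation (Y 1)"
          by (rule eq_reflection) (rule exp_Y[symmetric])
      qed simp
      have "prob (A n) \<le> 2 * exp (- 2 * real n * e\<^sup>2)"
        using H.Hoeffding_ineq_abs_ge'[of e] e False by (simp add: A_def dev_def)
      then show ?thesis by (simp add: mult.assoc mult.left_commute flip: exp_of_nat_mult)
    qed
    have "summable (\<lambda>n. prob (A n))"
    proof (rule summable_comparison_test')
      show "summable (\<lambda>n. 2 * exp (- 2 * e\<^sup>2) ^ n)"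
        using e by (intro summable_mult summable_geometric) simp
    qed (use A_le in auto)
    then have "AE \<omega> in M. \<forall>\<^sub>F n in sequentially. \<omega> \<in> space M - A n"
      by (intro borel_cantelli_AE1) (auto simp: A_def emeasure_eq_measure)
    then show ?thesis
      unfolding e_def[symmetric]
      by eventually_elim (auto elim!: eventually_mono simp: A_def)
  qed
  then have "AE \<omega> in M. \<forall>k. \<forall>\<^sub>F n in sequentially. dev n \<omega> < inverse (real (Suc k))"
    by (simp add: AE_all_countable)
  then show ?thesis
  proof eventually_elim
    case (elim \<omega>)
    show ?case
    proof (rule tendstoI)
      fix e :: real assume "e > 0"
      then obtain k where k: "inverse (real (Suc k)) < e"
        using reals_Archimedean by blast
      from elim[rule_format, of k]
      show "\<forall>\<^sub>F n in sequentially. dist ((\<Sum>i\<in>{1..n}. indicator {x} (Xs i \<omega>)) / real n) (pmf f0 x) < e"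
        by eventually_elim (use k in \<open>simp add: dev_def Y_def dist_real_def\<close>)
    qed
  qed
qed

text \<open>The image of the uniform law on the sample indices, so that sample means become
  expectations. It is meaningful only for \<open>n \<ge> 1\<close>, since \<open>{1..0}\<close> is
  empty.\<close>

definition empirical_pmf :: "(nat \<Rightarrow> 'x) \<Rightarrow> nat \<Rightarrow> 'x pmf"
  where "empirical_pmf xs n = map_pmf xs (pmf_of_set {1..n})"

lemma expectation_empirical_pmf:
  fixes g :: "'x \<Rightarrow> real"
  assumes "n \<ge> 1"
  shows "measure_pmf.expectation (empirical_pmf xs n) g = (\<Sum>i=1..n. g (xs i)) / real n"
  using assms by (simp add: empirical_pmf_def integral_pmf_of_set)

lemma set_empirical_pmf: "n \<ge> 1 \<Longrightarrow> set_pmf (empirical_pmf xs n) = xs ` {1..n}"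
  by (simp add: empirical_pmf_def)

lemma pmf_empirical_pmf:
  assumes "n \<ge> 1"
  shows "pmf (empirical_pmf xs n) x = (\<Sum>i\<in>{1..n}. indicator {x} (xs i)) / real n"
  using expectation_empirical_pmf[OF assms, of xs "indicator {x}"] by (simp add: measure_pmf_single)

text \<open>The support of a PMF is countable, so one null set serves all its points.\<close>

lemma (in prob_space) AE_empirical_pmf_tendsto:
  fixes Xs :: "nat \<Rightarrow> 'a \<Rightarrow> 'x"
  assumes indep: "indep_vars (\<lambda>_. count_space UNIV) Xs {1..}"
    and distr: "\<And>i. i \<ge> 1 \<Longrightarrow> distr M (count_space UNIV) (Xs i) = measure_pmf f0"
  shows "AE \<omega> in M. \<forall>x\<in>set_pmf f0. (\<lambda>n. pmf (empirical_pmf (\<lambda>i. Xs i \<omega>) n) x) \<longlonglongrightarrow> pmf f0 x"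
proof (subst AE_ball_countable[OF countable_set_pmf], intro ballI)
  fix x
  show "AE \<omega> in M. (\<lambda>n. pmf (empirical_pmf (\<lambda>i. Xs i \<omega>) n) x) \<longlonglongrightarrow> pmf f0 x"
  proof -
    have "AE \<omega> in M. (\<lambda>n. (\<Sum>i\<in>{1..n}. indicator {x} (Xs i \<omega>)) / real n) \<longlonglongrightarrow> pmf f0 x"
      using indep distr by (rule AE_frequency_tendsto)
    then show ?thesis
    proof eventually_elim
      case (elim \<omega>)
      have "\<forall>\<^sub>F n in sequentially. (\<Sum>i\<in>{1..n}. indicator {x} (Xs i \<omega>)) / real n =
          pmf (empirical_pmf (\<lambda>i. Xs i \<omega>) n) x"
        using eventually_ge_at_top[of 1] by eventually_elim (simp add: pmf_empirical_pmf)
      with elim show ?case by (rule Lim_transform_eventually)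
    qed
  qed
qed

lemma (in prob_space) AE_in_set_pmf:
  fixes Xs :: "nat \<Rightarrow> 'a \<Rightarrow> 'x"
  assumes indep: "indep_vars (\<lambda>_. count_space UNIV) Xs {1..}"
    and distr: "\<And>i. i \<ge> 1 \<Longrightarrow> distr M (count_space UNIV) (Xs i) = measure_pmf f0"
  shows "AE \<omega> in M. \<forall>i\<ge>1. Xs i \<omega> \<in> set_pmf f0"
proof -
  have "AE \<omega> in M. Xs i \<omega> \<in> set_pmf f0" if i: "i \<ge> 1" for i
  proof -
    have "Xs i \<in> measurable M (count_space UNIV)"
      using indep i by (auto simp: indep_vars_def)
    moreover have "AE x in distr M (count_space UNIV) (Xs i). x \<in> set_pmf f0"
      unfolding distr[OF i] by (simp add: AE_measure_pmf_iff)
    ultimately show ?thesis by (subst (asm) AE_distr_iff) auto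
  qed
  then show ?thesis by (simp add: AE_all_countable)
qed

section \<open>The pseudolikelihood as a weighted sum of log kernels\<close>

definition split_vec :: "'q set \<times> 'q set \<Rightarrow> int ^ 'q \<Rightarrow> ('q \<Rightarrow> int) \<times> ('q \<Rightarrow> int)"
  where "split_vec T x = (subvec (left_set T) x, subvec (right_set T) x)"

lemma conditional_eq_cond_kernel:
  "conditional T f a b = cond_kernel (map_pmf (split_vec T) f) a b"
proof -
  have "split_vec T -` {(a, b)} = {x. subvec (left_set T) x = a \<and> subvec (right_set T) x = b}"
    by (auto simp: split_vec_def)
  moreover have "(snd \<circ> split_vec T) -` {b} = {x. subvec (right_set T) x = b}"
    by (auto simp: split_vec_def)
  ultimately show ?thesis
    by (simp add: conditional_def cond_prob_def cond_kernel_def pmf.map_comp pmf_map)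
qed

lemma marginal_right_eq: "marginal (right_set T) f = map_pmf (snd \<circ> split_vec T) f"
  by (simp add: marginal_def split_vec_def comp_def)

lemma subvec_empty: "subvec {} = (\<lambda>_ _. undefined)"
  by (simp add: subvec_def restrict_def fun_eq_iff)

lemma pmf_marginal_empty: "pmf (marginal {} f) (\<lambda>_. undefined) = 1"
  by (simp add: marginal_def subvec_empty map_pmf_const)

text \<open>The empty subvector is the constant \<open>undefined\<close>, so the condition is
  certain and the conditional probability has denominator \<open>1\<close>.\<close>

lemma pmf_marginal_eq_conditional: "pmf (marginal S f) a = conditional (S, {}) f a (\<lambda>_. undefined)"
  by (simp add: conditional_def cond_prob_def subvec_empty marginal_def pmf_map vimage_def)

text \<open>
  A marginal is treated as a conditional given the empty set of coordinates, so that one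
  family of weighted terms covers both parts of the pseudolikelihood.
\<close>

definition relevant :: "('q set \<Rightarrow> real) \<Rightarrow> ('q set \<times> 'q set \<Rightarrow> real) \<Rightarrow> ('q set \<times> 'q set) set"
  where "relevant c d = (\<lambda>S. (S, {})) ` {S \<in> nonempty_subsets. c S \<noteq> 0} \<union> {T \<in> bipartitions. d T \<noteq> 0}"

text \<open>An empty right set marks a marginal term unambiguously, because both sets of a
  bipartition are non-empty.\<close>

definition weight :: "('q set \<Rightarrow> real) \<Rightarrow> ('q set \<times> 'q set \<Rightarrow> real) \<Rightarrow> 'q set \<times> 'q set \<Rightarrow> real"
  where "weight c d T = (if right_set T = {} then c (left_set T) else d T)"

definition cond_at :: "'q set \<times> 'q set \<Rightarrow> (int ^ 'q) pmf \<Rightarrow> int ^ 'q \<Rightarrow> real"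
  where "cond_at T f x = conditional T f (subvec (left_set T) x) (subvec (right_set T) x)"

text \<open>Terms with zero coefficient vanish even at \<open>-\<infinity>\<close>, and the marginal
  and conditional index families are disjoint, so both sums merge into one.\<close>

lemma log_pseudolikelihood_relevant:
  fixes c :: "'q::finite set \<Rightarrow> real"
  shows "log_pseudolikelihood c d n xs f =
    (\<Sum>i=1..n. \<Sum>T\<in>relevant c d. ereal (weight c d T) * log_prob (cond_at T f (xs i)))"
proof -
  have "(\<Sum>S\<in>nonempty_subsets. ereal (c S) * log_prob (pmf (marginal S f) (subvec S x))) +
      (\<Sum>T\<in>bipartitions. ereal (d T) *
        log_prob (conditional T f (subvec (left_set T) x) (subvec (right_set T) x))) =
      (\<Sum>T\<in>relevant c d. ereal (weight c d T) * log_prob (cond_at T f x))" (is "?l + ?r = ?s") for x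
  proof -
    have "?l = (\<Sum>S\<in>{S \<in> nonempty_subsets. c S \<noteq> 0}.
        ereal (c S) * log_prob (pmf (marginal S f) (subvec S x)))"
      by (rule sum.mono_neutral_right) auto
    also have "\<dots> = (\<Sum>T\<in>(\<lambda>S. (S, {})) ` {S \<in> nonempty_subsets. c S \<noteq> 0}.
        ereal (weight c d T) * log_prob (cond_at T f x))"
      by (subst sum.reindex)
        (auto simp: inj_on_def weight_def cond_at_def pmf_marginal_eq_conditional subvec_empty intro!: sum.cong)
    finally have l: "?l = \<dots>" .
    have "?r = (\<Sum>T\<in>{T \<in> bipartitions. d T \<noteq> 0}. ereal (d T) *
        log_prob (conditional T f (subvec (left_set T) x) (subvec (right_set T) x)))"
      by (rule sum.mono_neutral_right) auto
    also have "\<dots> = (\<Sum>T\<in>{T \<in> bipartitions. d T \<noteq> 0}. ereal (weight c d T) * log_prob (cond_at T f x))"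
      by (intro sum.cong) (auto simp: weight_def cond_at_def bipartitions_def)
    finally have r: "?r = \<dots>" .
    show ?thesis unfolding l r relevant_def
      by (rule sum.union_disjoint[symmetric]) (auto simp: bipartitions_def)
  qed
  then show ?thesis
    unfolding log_pseudolikelihood_def sum.distrib[symmetric] by simp
qed

text \<open>In \<open>ereal\<close> a summand \<open>-\<infinity>\<close> can be absorbed by
  \<open>\<infinity>\<close>; nonpositive terms exclude this.\<close>

lemma sum_nonpos_neq_MInf:
  fixes g :: "'a \<Rightarrow> ereal"
  assumes "finite A" and "\<And>x. x \<in> A \<Longrightarrow> g x \<le> 0" and "sum g A \<noteq> -\<infinity>" and "x \<in> A"
  shows "g x \<noteq> -\<infinity>"
proof
  assume "g x = -\<infinity>"
  moreover have "sum g A = g x + sum g (A - {x})"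
    using assms by (simp add: sum.remove)
  moreover have "sum g (A - {x}) \<le> 0"
    using assms by (intro sum_nonpos) auto
  ultimately show False using assms(3) by auto
qed

lemma log_prob_nonpos: "p \<ge> 0 \<Longrightarrow> p \<le> 1 \<Longrightarrow> log_prob p \<le> 0"
  by (auto simp: log_prob_def)

lemma cond_at_bounds: "cond_at T f x \<ge> 0" "cond_at T f x \<le> 1"
  by (simp_all add: cond_at_def conditional_eq_cond_kernel cond_kernel_nonneg cond_kernel_le_1)

lemma cond_at_pos_iff: "cond_at T f x > 0 \<longleftrightarrow> split_vec T x \<in> set_pmf (map_pmf (split_vec T) f)"
  unfolding cond_at_def conditional_eq_cond_kernel cond_kernel_pos_iff split_vec_def ..

lemma log_pseudolikelihood_eq_ereal:
  fixes c :: "'q::finite set \<Rightarrow> real"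
  assumes "\<And>i T. i \<in> {1..n} \<Longrightarrow> T \<in> relevant c d \<Longrightarrow> cond_at T f (xs i) > 0"
  shows "log_pseudolikelihood c d n xs f =
    ereal (\<Sum>i=1..n. \<Sum>T\<in>relevant c d. weight c d T * ln (cond_at T f (xs i)))"
proof -
  have "log_pseudolikelihood c d n xs f =
      (\<Sum>i=1..n. \<Sum>T\<in>relevant c d. ereal (weight c d T * ln (cond_at T f (xs i))))"
    unfolding log_pseudolikelihood_relevant
  proof (intro sum.cong refl)
    fix i T assume "i \<in> {1..n}" "T \<in> relevant c d"
    from assms[OF this] show "ereal (weight c d T) * log_prob (cond_at T f (xs i)) =
      ereal (weight c d T * ln (cond_at T f (xs i)))" by (simp add: log_prob_def)
  qed
  then show ?thesis by simp
qed

text \<open>A vanishing probability would contribute a positive weight times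
  \<open>-\<infinity>\<close>, and no other term could compensate, since all are
  nonpositive.\<close>

lemma cond_at_pos_if_log_pseudolikelihood:
  fixes c :: "'q::finite set \<Rightarrow> real"
  assumes w: "\<And>T. T \<in> relevant c d \<Longrightarrow> weight c d T > 0"
    and fin: "log_pseudolikelihood c d n xs f \<noteq> -\<infinity>"
    and i: "i \<in> {1..n}" and T: "T \<in> relevant c d"
  shows "cond_at T f (xs i) > 0"
proof -
  let ?g = "\<lambda>i T. ereal (weight c d T) * log_prob (cond_at T f (xs i))"
  have nonpos: "?g i T \<le> 0" if "T \<in> relevant c d" for i T
    using w[OF that] log_prob_nonpos[OF cond_at_bounds, of T f "xs i"]
    by (simp add: ereal_mult_le_0_iff)
  have "(\<Sum>i=1..n. \<Sum>T\<in>relevant c d. ?g i T) \<noteq> -\<infinity>"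
    using fin by (simp add: log_pseudolikelihood_relevant)
  then have "(\<Sum>T\<in>relevant c d. ?g i T) \<noteq> -\<infinity>"
    by (rule sum_nonpos_neq_MInf[rotated 2]) (use i nonpos in \<open>auto intro!: sum_nonpos\<close>)
  then have "?g i T \<noteq> -\<infinity>"
    by (rule sum_nonpos_neq_MInf[rotated 2]) (use T nonpos in auto)
  then show ?thesis
    using w[OF T] cond_at_bounds(1)[of T f "xs i"] by (auto simp: log_prob_def less_le)
qed

section \<open>Consistency along one sample path\<close>

text \<open>All randomness is gone: \<open>xs\<close> is a fixed path whose empirical PMFs converge.
  The work is to pass from the extended-real maximum to the real inequality and the support
  condition that \<open>cond_kernel_consistency\<close> asks for.\<close>

lemma max_pseudolikelihood_consistent:
  fixes c :: "'q::finite set \<Rightarrow> real" and xs :: "nat \<Rightarrow> int ^ 'q"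
  assumes w: "\<And>T. T \<in> relevant c d \<Longrightarrow> weight c d T > 0"
    and f0: "f0 \<in> F" and fin: "finite (set_pmf f0)"
    and xs: "\<And>i. i \<ge> 1 \<Longrightarrow> xs i \<in> set_pmf f0"
    and conv: "\<And>x. x \<in> set_pmf f0 \<Longrightarrow> (\<lambda>n. pmf (empirical_pmf xs n) x) \<longlonglongrightarrow> pmf f0 x"
    and max: "\<And>n. n \<ge> 1 \<Longrightarrow> is_max_pseudolikelihood F c d n xs (f n)"
    and T: "T \<in> relevant c d" and b: "pmf (marginal (right_set T) f0) b > 0"
  shows "(\<lambda>n. conditional T (f n) a b) \<longlonglongrightarrow> conditional T f0 a b"
    and "\<forall>\<^sub>F n in sequentially. pmf (marginal (right_set T) (f n)) b > 0"
proof -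
  have f0_pos: "cond_at T f0 (xs i) > 0" if "i \<ge> 1" for T i
    using xs[OF that] by (simp add: cond_at_pos_iff)
  have le: "log_pseudolikelihood c d n xs f0 \<le> log_pseudolikelihood c d n xs (f n)" if "n \<ge> 1" for n
    using max[OF that] f0 by (simp add: is_max_pseudolikelihood_def is_arg_max_linorder)
  have f0_eq: "log_pseudolikelihood c d n xs f0 =
      ereal (\<Sum>i=1..n. \<Sum>T\<in>relevant c d. weight c d T * ln (cond_at T f0 (xs i)))" for n
    by (rule log_pseudolikelihood_eq_ereal) (simp add: f0_pos)
  \<comment> \<open>The path stays in the support of \<open>f0\<close>, so \<open>f0\<close> has a
    finite likelihood; the maximiser does at least as well and cannot have
    \<open>-\<infinity>\<close>.\<close>
  have f_pos: "cond_at T (f n) (xs i) > 0" if "i \<in> {1..n}" "T \<in> relevant c d" for n i T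
    by (rule cond_at_pos_if_log_pseudolikelihood[OF w _ that]) (use le[of n] f0_eq[of n] that in auto)
  have f_eq: "log_pseudolikelihood c d n xs (f n) =
      ereal (\<Sum>i=1..n. \<Sum>T\<in>relevant c d. weight c d T * ln (cond_at T (f n) (xs i)))" for n
    by (rule log_pseudolikelihood_eq_ereal) (rule f_pos)
  have sum_le: "(\<Sum>i=1..n. \<Sum>T\<in>relevant c d. weight c d T * ln (cond_at T f0 (xs i))) \<le>
      (\<Sum>i=1..n. \<Sum>T\<in>relevant c d. weight c d T * ln (cond_at T (f n) (xs i)))" if "n \<ge> 1" for n
    using le[OF that] unfolding f0_eq f_eq by (simp only: ereal_less_eq)
  have cond_at_eq: "cond_at T g x = cond_kernel (map_pmf (split_vec T) g) (fst (split_vec T x)) (snd (split_vec T x))"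
    for T g x by (simp add: cond_at_def conditional_eq_cond_kernel split_vec_def)
  have ge1: "\<forall>\<^sub>F n in sequentially. n \<ge> (1::nat)" by (rule eventually_ge_at_top)
  have "\<forall>\<^sub>F n in sequentially. set_pmf (empirical_pmf xs n) \<subseteq> set_pmf f0"
    using ge1 by eventually_elim (auto simp: set_empirical_pmf xs)
  moreover have "\<forall>\<^sub>F n in sequentially. \<forall>T\<in>relevant c d.
      set_pmf (map_pmf (split_vec T) (empirical_pmf xs n)) \<subseteq> set_pmf (map_pmf (split_vec T) (f n))"
    using ge1
  proof eventually_elim
    case (elim n)
    have "split_vec T (xs i) \<in> split_vec T ` set_pmf (f n)" if "i \<in> {1..n}" "T \<in> relevant c d" for i T
      using f_pos[OF that] by (simp add: cond_at_pos_iff)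
    then show ?case
      unfolding set_map_pmf set_empirical_pmf[OF elim] image_image by (blast intro: image_subsetI)
  qed
  \<comment> \<open>Dividing the likelihoods by \<open>n\<close> turns them into expectations under
    the empirical PMF.\<close>
  moreover have "\<forall>\<^sub>F n in sequentially.
      measure_pmf.expectation (empirical_pmf xs n) (\<lambda>x. \<Sum>T\<in>relevant c d. weight c d T * ln (cond_at T f0 x)) \<le>
      measure_pmf.expectation (empirical_pmf xs n) (\<lambda>x. \<Sum>T\<in>relevant c d. weight c d T * ln (cond_at T (f n) x))"
    using ge1
    by eventually_elim (simp only: expectation_empirical_pmf divide_right_mono sum_le of_nat_0_le_iff)
  ultimately show "(\<lambda>n. conditional T (f n) a b) \<longlonglongrightarrow> conditional T f0 a b"
    and "\<forall>\<^sub>F n in sequentially. pmf (marginal (right_set T) (f n)) b > 0"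
    using b w fin conv T finite[of "relevant c d"]
      cond_kernel_consistency(1)[where J = "relevant c d" and w = "weight c d" and U = split_vec
        and P = "empirical_pmf xs" and f = f and i = T and b = b and a = a, folded cond_at_eq]
      cond_kernel_consistency(2)[where J = "relevant c d" and w = "weight c d" and U = split_vec
        and P = "empirical_pmf xs" and f = f and i = T and b = b, folded cond_at_eq]
    unfolding marginal_right_eq conditional_eq_cond_kernel by blast+
qed

section \<open>Finiteness for bounded \<open>X\<close> and the almost sure statement\<close>

lemma finite_of_bounded_int_vec:
  fixes X :: "(int ^ 'q::finite) set"
  assumes "bounded ((\<lambda>x. \<chi> i. real_of_int (x $ i)) ` X :: (real ^ 'q) set)"
  shows "finite X"
proof -
  obtain B where B: "norm (\<chi> i. real_of_int (x $ i) :: real ^ 'q) \<le> B" if "x \<in> X" for x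
    using assms by (auto simp: bounded_iff)
  \<comment> \<open>Each coordinate is bounded by the norm, so \<open>X\<close> lies in a finite box
    of integer points.\<close>
  have "X \<subseteq> (\<lambda>g. \<chi> i. g i) ` PiE UNIV (\<lambda>_. {\<lfloor>- B\<rfloor>..\<lceil>B\<rceil>})"
  proof
    fix x assume x: "x \<in> X"
    have "x $ i \<in> {\<lfloor>- B\<rfloor>..\<lceil>B\<rceil>}" for i
      using order_trans[OF component_le_norm_cart[of "\<chi> i. real_of_int (x $ i)" i] B[OF x]]
      by (simp add: abs_le_iff) linarith
    then show "x \<in> (\<lambda>g. \<chi> i. g i) ` PiE UNIV (\<lambda>_. {\<lfloor>- B\<rfloor>..\<lceil>B\<rceil>})"
      by (intro image_eqI[of _ _ "\<lambda>i. x $ i"]) (auto simp: vec_eq_iff)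
  qed
  then show ?thesis
    by (rule finite_subset) (intro finite_imageI finite_PiE, auto)
qed

lemma pseudo_entropy_finite:
  fixes X :: "(int ^ 'q::finite) set"
  assumes "finite X"
  shows "\<bar>pseudo_entropy X c d f\<bar> \<noteq> \<infinity>"
proof -
  have "finite (coords A X)" for A :: "'q set"
    using assms by (simp add: coords_def)
  then show ?thesis by (simp add: pseudo_entropy_def)
qed

theorem mainTheorem2:
  fixes X :: "(int ^ 'q::finite) set"
    and F :: "(int ^ 'q) pmf set"
    and c :: "'q set \<Rightarrow> real"
    and d :: "'q set \<times> 'q set \<Rightarrow> real"
    and M :: "'w measure"
    and Xs :: "nat \<Rightarrow> 'w \<Rightarrow> int ^ 'q"
    and f0 :: "(int ^ 'q) pmf"
  assumes F: "\<forall>f\<in>F. set_pmf f \<subseteq> X"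
    and c: "\<forall>S\<in>nonempty_subsets. c S \<ge> 0"
    and d: "\<forall>T\<in>bipartitions. d T \<ge> 0"
    and cd: "(\<exists>S\<in>nonempty_subsets. c S \<noteq> 0) \<or> (\<exists>T\<in>bipartitions. d T \<noteq> 0)"
    and f0: "f0 \<in> F"
    and M: "prob_space M"
    and indep: "prob_space.indep_vars M (\<lambda>_. count_space UNIV) Xs {1..}"
    and distr: "\<forall>i\<ge>1. distr M (count_space UNIV) (Xs i) = measure_pmf f0"
  shows "(\<exists>y\<in>{0..1::real}. - y * ln y = 1 / exp 1) \<and>
    (\<forall>y\<in>{0..1::real}. - y * ln y \<le> 1 / exp 1) \<and>
    (bounded ((\<lambda>x. \<chi> i. real_of_int (x $ i)) ` X :: (real ^ 'q) set) \<longrightarrow>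
      (\<forall>S\<in>nonempty_subsets. finite (coords S X)) \<and>
      \<bar>pseudo_entropy X c d f0\<bar> \<noteq> \<infinity> \<and>
      (\<forall>(ft :: nat \<Rightarrow> 'w \<Rightarrow> (int ^ 'q) pmf)
        (ftS :: nat \<Rightarrow> 'w \<Rightarrow> 'q set \<Rightarrow> ('q \<Rightarrow> int) pmf)
        (ftT :: nat \<Rightarrow> 'w \<Rightarrow> 'q set \<times> 'q set \<Rightarrow> ('q \<Rightarrow> int) \<Rightarrow> ('q \<Rightarrow> int) pmf).
        (AE \<omega> in M. \<forall>n\<ge>1.
          is_max_pseudolikelihood F c d n (\<lambda>i. Xs i \<omega>) (ft n \<omega>) \<and>
          compatible c d (ft n \<omega>) (ftS n \<omega>) (ftT n \<omega>)) \<longrightarrow>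
        (AE \<omega> in M.
          (\<forall>S\<in>nonempty_subsets. c S \<noteq> 0 \<longrightarrow>
            (\<forall>x\<in>coords S X.
              (\<lambda>n. pmf (ftS n \<omega> S) x) \<longlonglongrightarrow> pmf (marginal S f0) x)) \<and>
          (\<forall>T\<in>bipartitions. d T \<noteq> 0 \<longrightarrow>
            (\<forall>a\<in>coords (left_set T) X. \<forall>b\<in>coords (right_set T) X.
              pmf (marginal (right_set T) f0) b > 0 \<longrightarrow>
              (\<lambda>n. pmf (ftT n \<omega> T b) a) \<longlonglongrightarrow> conditional T f0 a b)))))"
proof (intro conjI impI allI)
  show "\<exists>y\<in>{0..1::real}. - y * ln y = 1 / exp 1"
  proof
    \<comment> \<open>The maximum is attained at \<open>y = exp (- 1)\<close>.\<close>
    show "- exp (- 1) * ln (exp (- 1 :: real)) = 1 / exp 1"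
      unfolding ln_exp by (simp add: exp_minus divide_inverse)
  qed simp
  show "\<forall>y\<in>{0..1::real}. - y * ln y \<le> 1 / exp 1"
    using neg_mult_ln_le by auto
next
  assume "bounded ((\<lambda>x. \<chi> i. real_of_int (x $ i)) ` X :: (real ^ 'q) set)"
  then have X: "finite X" by (rule finite_of_bounded_int_vec)
  then show "\<forall>S\<in>nonempty_subsets. finite (coords S X)"
    by (simp add: coords_def)
  show "\<bar>pseudo_entropy X c d f0\<bar> \<noteq> \<infinity>"
    using X by (rule pseudo_entropy_finite)
  fix ft ftS ftT
  assume max: "AE \<omega> in M. \<forall>n\<ge>1.
    is_max_pseudolikelihood F c d n (\<lambda>i. Xs i \<omega>) (ft n \<omega>) \<and>
    compatible c d (ft n \<omega>) (ftS n \<omega>) (ftT n \<omega>)"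
  interpret prob_space M by fact
  have w: "weight c d T > 0" if "T \<in> relevant c d" for T
    using that unfolding relevant_def
  proof
    assume "T \<in> {T \<in> bipartitions. d T \<noteq> 0}"
    then show ?thesis using d[rule_format, of T] by (simp add: weight_def bipartitions_def case_prod_unfold)
  next
    assume "T \<in> (\<lambda>S. (S, {})) ` {S \<in> nonempty_subsets. c S \<noteq> 0}"
    then obtain S where "T = (S, {})" "S \<in> nonempty_subsets" "c S \<noteq> 0" by blast
    then show ?thesis using c[rule_format, of S] by (simp add: weight_def)
  qed
  have fin: "finite (set_pmf f0)" using F f0 X by (auto intro: finite_subset)
  have distr': "distr M (count_space UNIV) (Xs i) = measure_pmf f0" if "i \<ge> 1" for i
    using distr that by simp
  have "AE \<omega> in M. \<forall>i\<ge>1. Xs i \<omega> \<in> set_pmf f0"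
    using indep distr' by (rule AE_in_set_pmf)
  moreover have "AE \<omega> in M. \<forall>x\<in>set_pmf f0.
      (\<lambda>n. pmf (empirical_pmf (\<lambda>i. Xs i \<omega>) n) x) \<longlonglongrightarrow> pmf f0 x"
    using indep distr' by (rule AE_empirical_pmf_tendsto)
  ultimately show "AE \<omega> in M.
      (\<forall>S\<in>nonempty_subsets. c S \<noteq> 0 \<longrightarrow>
        (\<forall>x\<in>coords S X. (\<lambda>n. pmf (ftS n \<omega> S) x) \<longlonglongrightarrow> pmf (marginal S f0) x)) \<and>
      (\<forall>T\<in>bipartitions. d T \<noteq> 0 \<longrightarrow>
        (\<forall>a\<in>coords (left_set T) X. \<forall>b\<in>coords (right_set T) X.
          pmf (marginal (right_set T) f0) b > 0 \<longrightarrow>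
          (\<lambda>n. pmf (ftT n \<omega> T b) a) \<longlonglongrightarrow> conditional T f0 a b))"
    using max
  \<comment> \<open>Three almost sure events meet here: observations in the support, convergence of
    the empirical PMFs, and maximality with compatibility. The rest is deterministic.\<close>
  proof eventually_elim
    case (elim \<omega>)
    note cons = max_pseudolikelihood_consistent
      [OF w f0 fin, of "\<lambda>i. Xs i \<omega>" "\<lambda>n. ft n \<omega>"]
    have comp: "compatible c d (ft n \<omega>) (ftS n \<omega>) (ftT n \<omega>)" if "n \<ge> 1" for n
      using elim(3) that by blast
    have ge1: "\<forall>\<^sub>F n in sequentially. n \<ge> (1::nat)" by (rule eventually_ge_at_top)
    have "(\<lambda>n. pmf (ftS n \<omega> S) x) \<longlonglongrightarrow> pmf (marginal S f0) x"
      if S: "S \<in> nonempty_subsets" "c S \<noteq> 0" for S x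
    proof -
      have "(S, {}) \<in> relevant c d" using S by (auto simp: relevant_def)
      then have "(\<lambda>n. conditional (S, {}) (ft n \<omega>) x (\<lambda>_. undefined)) \<longlonglongrightarrow>
          conditional (S, {}) f0 x (\<lambda>_. undefined)"
        using elim by (intro cons) (auto simp: pmf_marginal_empty)
      then have "(\<lambda>n. pmf (marginal S (ft n \<omega>)) x) \<longlonglongrightarrow> pmf (marginal S f0) x"
        by (simp add: pmf_marginal_eq_conditional)
      moreover have "\<forall>\<^sub>F n in sequentially. pmf (marginal S (ft n \<omega>)) x = pmf (ftS n \<omega> S) x"
        using ge1 by eventually_elim (use comp S in \<open>simp add: compatible_def\<close>)
      ultimately show ?thesis by (rule Lim_transform_eventually)
    qed
    moreover have "(\<lambda>n. pmf (ftT n \<omega> T b) a) \<longlonglongrightarrow> conditional T f0 a b"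
      if T: "T \<in> bipartitions" "d T \<noteq> 0" and b: "pmf (marginal (right_set T) f0) b > 0" for T a b
    proof -
      have rel: "T \<in> relevant c d" using T by (auto simp: relevant_def)
      have "(\<lambda>n. conditional T (ft n \<omega>) a b) \<longlonglongrightarrow> conditional T f0 a b"
        using elim rel b by (intro cons) auto
      \<comment> \<open>Compatibility fixes \<open>ftT n \<omega> T b\<close> only where
        \<open>b\<close> has positive mass under \<open>ft n \<omega>\<close>, so this must hold
        eventually before the limit can be transferred.\<close>
      moreover have "\<forall>\<^sub>F n in sequentially. pmf (marginal (right_set T) (ft n \<omega>)) b > 0"
        using elim rel b by (intro cons) auto
      then have "\<forall>\<^sub>F n in sequentially. conditional T (ft n \<omega>) a b = pmf (ftT n \<omega> T b) a"
        using ge1 by eventually_elim (use comp T in \<open>simp add: compatible_def\<close>)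
      ultimately show ?thesis by (rule Lim_transform_eventually)
    qed
    ultimately show ?case by blast
  qed
qed

end
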